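(* Let $p$ be a prime, $q=p^{r}$, $k\geq 3$ with $k\mid(q-1)$, $F=\mathrm{GF}(q)$, and $\Phi$ the unique multiplicative subgroup of $F^{*}$ of order $k$. For $a,c\in F^{*}$ let $[a,c]_{k}=|\Phi\cap(\Phi a+c)|$. Suppose $(p,k)$ is circular and let $a\in F^{*}$. If $k$ is even, then \[ [a,1]_{k}=\begin{cases}2, & \text{if } a\in\Phi(\psi-1) \text{ for some } \psi\in\Phi\setminus\{1,-1\};\\ 1, & \text{if } a\in 2\Phi;\\ 0, & \text{otherwise}.\end{cases} \] If $k$ is odd, then \[ [a,1]_{k}=\begin{cases}2, & \text{if } p=2 \text{ and } a\in\Phi(\psi-1) \text{ for some } \psi\in\Phi\setminus\{1\};\\ 1, & \text{if } p\neq 2 \text{ and } a\in\Phi(\psi-1) \text{ for some } \psi\in\Phi\setminus\{1\};\\ 0, & \text{otherwise}.\end{cases} \]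
   Context: For a finite field $E$ and its multiplicative subgroup $\Psi$ of order $k$, the pair $(E,\Psi)$ is circular if $|\Psi a\cap(\Psi b+c)|\leq 2$ for all $a,b,c\in E^{*}$. The pair $(p,k)$ is called circular if $(\mathrm{GF}(p^{r'}),\Psi)$ is circular for some $r'\in\mathbb{N}$ with $k\mid(p^{r'}-1)$; it is known (Modisett) that then $(\mathrm{GF}(p^{r}),\Phi)$ is circular for every $r$ with $k\mid(p^{r}-1)$. *)

theory Defs
  imports "HOL-Algebra.AbelCoset" "HOL-Algebra.Multiplicative_Group" "HOL-Computational_Algebra.Primes"
begin

definition scaled_translate :: "('a, 'm) ring_scheme \<Rightarrow> 'a set \<Rightarrow> 'a \<Rightarrow> 'a \<Rightarrow> 'a set" where
  "scaled_translate F \<Phi> a c = (\<Phi> #>\<^bsub>F\<^esub> a) +>\<^bsub>F\<^esub> c"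

(* This is [a,c]_k, with k = card \<Phi>. *)
definition bracket :: "('a, 'm) ring_scheme \<Rightarrow> 'a set \<Rightarrow> 'a \<Rightarrow> 'a \<Rightarrow> nat" where
  "bracket F \<Phi> a c = card (\<Phi> \<inter> scaled_translate F \<Phi> a c)"

definition is_GF :: "nat \<Rightarrow> ('a, 'm) ring_scheme \<Rightarrow> bool" where
  "is_GF q F \<longleftrightarrow> field F \<and> finite (carrier F) \<and> card (carrier F) = q"

definition circular :: "('a, 'm) ring_scheme \<Rightarrow> 'a set \<Rightarrow> bool" where
  "circular E \<Psi> \<longleftrightarrow>
     (\<forall>a \<in> carrier (Multiplicative_Group.mult_of E).
      \<forall>b \<in> carrier (Multiplicative_Group.mult_of E).
      \<forall>c \<in> carrier (Multiplicative_Group.mult_of E).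
        card ((\<Psi> #>\<^bsub>E\<^esub> a) \<inter> scaled_translate E \<Psi> b c) \<le> 2)"

(* Every finite field has an isomorphic copy whose carrier is a set of natural numbers, so
   quantifying over nat ring covers all fields GF(p^r). A finite field has exactly one
   multiplicative subgroup of order k when k divides p^r - 1, so quantifying existentially
   over \<Psi> picks that subgroup. *)
definition circular_pair :: "nat \<Rightarrow> nat \<Rightarrow> bool" where
  "circular_pair p k \<longleftrightarrow>
     (\<exists>(r::nat) (E :: nat ring) \<Psi>.
        k dvd p ^ r - 1 \<and> is_GF (p ^ r) E \<and>
        subgroup \<Psi> (Multiplicative_Group.mult_of E) \<and> card \<Psi> = k \<and> circular E \<Psi>)"

end

theory Submission
  imports Defs "HOL-Computational_Algebra.Polynomial"
begin

text \<open>
  Three points in the intersection of \<open>\<Phi>a\<close> and \<open>\<Phi>b + c\<close> amount to an integer polynomial relation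
  between elements of \<open>\<Phi>\<close>. Integer relations satisfied by a suitable primitive \<open>k\<close>-th root of unity
  of \<open>F\<close> also hold for one in any other finite field of characteristic \<open>p\<close>, so
  circularity of one field of characteristic \<open>p\<close> carries over to \<open>F\<close>.

  The elements \<open>\<psi>\<close> counted by \<open>[a,1]\<close> are those in \<open>\<Phi> - {1}\<close> with \<open>a \<in> \<Phi>(\<psi> - 1)\<close>, and there are at most
  two of them. If \<open>-1 \<in> \<Phi>\<close>, this set is closed under inversion, whose fixed points are \<open>1\<close> and \<open>-1\<close>, and
  \<open>\<psi> = -1\<close> occurs exactly for \<open>a \<in> 2\<Phi>\<close>. If \<open>-1 \<notin> \<Phi>\<close>, two such elements would produce three points in the
  intersection of \<open>\<Phi>\<close> with some \<open>e - \<Phi>\<close>.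
\<close>

subsection \<open>Evaluating integer polynomials in a finite domain\<close>

context ring begin

definition int_emb :: "int \<Rightarrow> 'a" where
  "int_emb n = [n] \<cdot> \<one>"

lemma int_emb_closed [simp]: "int_emb n \<in> carrier R"
  by (simp add: int_emb_def)

lemma int_emb_0 [simp]: "int_emb 0 = \<zero>"
  by (simp add: int_emb_def add_pow_def)

lemma int_emb_1 [simp]: "int_emb 1 = \<one>"
  by (simp add: int_emb_def)

lemma int_emb_add: "int_emb (m + n) = int_emb m \<oplus> int_emb n"
  by (simp add: int_emb_def add.int_pow_mult)

lemma int_emb_mult: "int_emb (m * n) = int_emb m \<otimes> int_emb n"
  by (simp add: int_emb_def add_pow_ldistr_int add.int_pow_pow mult.commute)

lemma int_emb_sum: "finite A \<Longrightarrow> int_emb (sum f A) = (\<Oplus>i\<in>A. int_emb (f i))"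
  by (induction A rule: finite_induct) (auto simp: int_emb_add)

lemma int_emb_of_nat_power: "int_emb (int n ^ r) = int_emb (int n) [^] r"
  by (induction r) (simp_all add: int_emb_mult flip: nat_pow_Suc2)

end

text \<open>In the additive group, 1 multiplied by the group order \<open>p ^ r\<close> is 0. A
  domain has no nonzero nilpotents, so already p times 1 vanishes.\<close>

lemma (in domain) int_emb_char_eq_0:
  assumes "finite (carrier R)" "card (carrier R) = p ^ r"
  shows "int_emb (int p) = \<zero>"
proof -
  have "[card (carrier R)] \<cdot> \<one> = \<zero>"
    using add.pow_order_eq_1[of \<one>] by (simp add: Coset.order_def add_pow_def)
  hence "int_emb (int (p ^ r)) = \<zero>"
    using assms by (simp add: int_emb_def add_pow_int_ge nat_power_eq)
  hence "int_emb (int p) [^] r = \<zero>"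
    by (simp add: int_emb_of_nat_power)
  thus ?thesis
    by (induction r) (auto simp: integral_iff)
qed

text \<open>If a non-multiple of \<open>p\<close> were sent to 0, a Bezout combination would give 1
  = 0. The kernel depends on \<open>p\<close> alone, so congruences between coefficients pass from
  one field of characteristic \<open>p\<close> to another.\<close>

lemma (in domain) int_emb_eq_0_iff:
  assumes "finite (carrier R)" "card (carrier R) = p ^ r" "Factorial_Ring.prime p"
  shows "int_emb n = \<zero> \<longleftrightarrow> int p dvd n"
proof
  assume "int p dvd n"
  then obtain m where "n = int p * m" ..
  thus "int_emb n = \<zero>"
    using int_emb_char_eq_0[OF assms(1,2)] by (simp add: int_emb_mult)
next
  assume 0: "int_emb n = \<zero>"
  show "int p dvd n"
  proof (rule ccontr)
    assume "\<not> int p dvd n"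
    hence "coprime (int p) n"
      using assms(3) by (simp add: prime_imp_coprime)
    then obtain u v where "u * int p + v * n = 1"
      by (metis bezout_int coprime_iff_gcd_eq_1)
    hence "int_emb (u * int p + v * n) = \<one>" by simp
    thus False
      using 0 int_emb_char_eq_0[OF assms(1,2)] by (simp add: int_emb_add int_emb_mult)
  qed
qed

context domain begin

definition poly_emb :: "int poly \<Rightarrow> nat \<Rightarrow> 'a" where
  "poly_emb P = (\<lambda>i. int_emb (Polynomial.coeff P i))"

text \<open>Integer coefficients allow one and the same polynomial to be evaluated in two fields
  whose carrier types are unrelated.\<close>

definition ipoly :: "int poly \<Rightarrow> 'a \<Rightarrow> 'a" where
  "ipoly P x = eval R R id x (poly_emb P)"

lemma UP_domain_R: "UP_domain R"
  by unfold_locales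

lemma poly_emb_closed [simp]: "poly_emb P \<in> carrier (UP R)"
  by (auto simp: UP_def poly_emb_def Polynomial.coeff_eq_0
      intro!: mem_upI exI[of _ "degree P"] bound.intro)

lemma coeff_poly_emb [simp]:
  "UnivPoly.coeff (UP R) (poly_emb P) i = int_emb (Polynomial.coeff P i)"
  using poly_emb_closed[of P] by (simp add: UP_def poly_emb_def)

lemma poly_emb_add: "poly_emb (P + Q) = poly_emb P \<oplus>\<^bsub>UP R\<^esub> poly_emb Q"
proof -
  interpret UP: UP_domain R "UP R" by (simp_all add: UP_domain_R)
  show ?thesis by (rule UP.up_eqI) (auto simp: int_emb_add)
qed

lemma poly_emb_mult: "poly_emb (P * Q) = poly_emb P \<otimes>\<^bsub>UP R\<^esub> poly_emb Q"
proof -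
  interpret UP: UP_domain R "UP R" by (simp_all add: UP_domain_R)
  show ?thesis
    by (rule UP.up_eqI) (auto simp: int_emb_sum int_emb_mult Polynomial.coeff_mult)
qed

lemma poly_emb_monom: "poly_emb (Polynomial.monom 1 n) = UnivPoly.monom (UP R) \<one> n"
proof -
  interpret UP: UP_domain R "UP R" by (simp_all add: UP_domain_R)
  show ?thesis by (rule UP.up_eqI) auto
qed

context
  fixes x assumes x: "x \<in> carrier R"
begin

lemma ipoly_closed [simp]: "ipoly P x \<in> carrier R"
proof -
  interpret UP: UP_domain R "UP R" by (simp_all add: UP_domain_R)
  show ?thesis using x by (simp add: ipoly_def UP.carrier_evalRR)
qed

lemma ipoly_add: "ipoly (P + Q) x = ipoly P x \<oplus> ipoly Q x"
proof -
  interpret UP: UP_domain R "UP R" by (simp_all add: UP_domain_R)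
  show ?thesis using x by (simp add: ipoly_def poly_emb_add UP.evalRR_add)
qed

lemma ipoly_mult: "ipoly (P * Q) x = ipoly P x \<otimes> ipoly Q x"
proof -
  interpret UP: UP_domain R "UP R" by (simp_all add: UP_domain_R)
  show ?thesis using x by (simp add: ipoly_def poly_emb_mult UP.evalRR_mult)
qed

lemma ipoly_monom: "ipoly (Polynomial.monom 1 n) x = x [^] n"
proof -
  interpret UP: UP_domain R "UP R" by (simp_all add: UP_domain_R)
  show ?thesis using x by (simp add: ipoly_def poly_emb_monom UP.evalRR_monom)
qed

lemma ipoly_1: "ipoly 1 x = \<one>"
  using ipoly_monom[of 0] by simp

lemma ipoly_0: "ipoly 0 x = \<zero>"
  using ipoly_add[of 0 0] by simp

lemma ipoly_diff: "ipoly (P - Q) x = ipoly P x \<ominus> ipoly Q x"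
proof -
  have "ipoly P x = ipoly (P - Q) x \<oplus> ipoly Q x"
    by (simp flip: ipoly_add)
  thus ?thesis by (simp add: minus_eq a_assoc r_neg)
qed

lemma ipoly_prod_eq_0:
  assumes "finite A" "ipoly (\<Prod>i\<in>A. f i) x = \<zero>"
  shows "\<exists>i\<in>A. ipoly (f i) x = \<zero>"
  using assms
  by (induction A rule: finite_induct) (auto simp: ipoly_1 ipoly_mult integral_iff)

end

text \<open>A nonzero polynomial over a domain has at most as many roots as its degree. Only the
  images of the coefficients vanish; the integers themselves may be nonzero multiples of the
  characteristic.\<close>

lemma int_emb_coeff_eq_0_if_many_roots:
  assumes "finite (carrier R)" "S \<subseteq> carrier R"
    and "\<And>x. x \<in> S \<Longrightarrow> ipoly P x = \<zero>" and "degree P < card S"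
  shows "int_emb (Polynomial.coeff P i) = \<zero>"
proof -
  interpret UP: UP_domain R "UP R" by (simp_all add: UP_domain_R)
  have "poly_emb P = \<zero>\<^bsub>UP R\<^esub>"
  proof (rule ccontr)
    assume nz: "poly_emb P \<noteq> \<zero>\<^bsub>UP R\<^esub>"
    let ?Z = "{a \<in> carrier R. eval R R id a (poly_emb P) = \<zero>}"
    have "card S \<le> card ?Z"
      using assms by (intro card_mono) (auto simp: ipoly_def)
    also have "\<dots> \<le> deg R (poly_emb P)"
      using UP.roots_bound[OF _ nz assms(1)] by simp
    also have "\<dots> \<le> degree P"
      by (rule UP.deg_aboveI) (auto simp: Polynomial.coeff_eq_0)
    finally show False using assms(4) by simp
  qed
  thus ?thesis
    by (metis coeff_poly_emb UP.coeff_zero)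
qed

lemma ipoly_eq_0_if_coeffs:
  assumes "\<And>i. int_emb (Polynomial.coeff P i) = \<zero>" "x \<in> carrier R"
  shows "ipoly P x = \<zero>"
proof -
  interpret UP: UP_domain R "UP R" by (simp_all add: UP_domain_R)
  have "poly_emb P = poly_emb 0"
    by (rule UP.up_eqI) (auto simp: assms)
  thus ?thesis using ipoly_0[OF assms(2)] by (simp add: ipoly_def)
qed

end

subsection \<open>Roots of unity\<close>

lemma (in group) subgroup_pow_card_eq_1:
  assumes "subgroup H G" "x \<in> H"
  shows "x [^] card H = \<one>"
proof -
  interpret H: group "G\<lparr>carrier := H\<rparr>"
    using assms(1) by (simp add: subgroup.subgroup_is_group)
  show ?thesis
    using H.pow_order_eq_1[of x] assms(2) by (simp add: Coset.order_def flip: nat_pow_consistent)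
qed

text \<open>With k = \<open>card H\<close>, the polynomial X^k - 1 has at most k roots, and the k
  elements of \<open>H\<close> are roots by Lagrange. Membership in \<open>H\<close> thus becomes a
  test on a power.\<close>

lemma (in field) finite_subgroup_eq_roots:
  assumes "finite (carrier R)" "subgroup H (mult_of R)"
  shows "H = {x \<in> carrier R. x [^] card H = \<one>}"
proof -
  interpret M: group "mult_of R" by (rule field_mult_group)
  have sub: "H \<subseteq> carrier R" using subgroup.subset[OF assms(2)] by auto
  hence "finite H" using assms(1) finite_subset by blast
  moreover have "H \<noteq> {}" using subgroup.one_closed[OF assms(2)] by auto
  ultimately have "card H \<noteq> 0" by simp
  show ?thesis
  proof (rule card_seteq)
    show "finite {x \<in> carrier R. x [^] card H = \<one>}" using assms(1) by simp
    show "H \<subseteq> {x \<in> carrier R. x [^] card H = \<one>}"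
      using sub M.subgroup_pow_card_eq_1[OF assms(2)] by (auto simp: nat_pow_mult_of)
    show "card {x \<in> carrier R. x [^] card H = \<one>} \<le> card H"
      by (rule num_roots_le_deg[OF assms(1) \<open>card H \<noteq> 0\<close>])
  qed
qed

text \<open>The multiplicative group is cyclic with a generator g. If its order is
  \<open>card H * m\<close>, then g^m has order \<open>card H\<close>, and it lies in
  \<open>H\<close> because \<open>H\<close> contains all roots of unity of that order.\<close>

lemma (in field) finite_subgroup_primitive_root:
  assumes "finite (carrier R)" "subgroup H (mult_of R)"
  obtains z where "z \<in> H" "\<And>n::nat. z [^] n = \<one> \<longleftrightarrow> card H dvd n"
proof -
  interpret M: group "mult_of R" by (rule field_mult_group)
  note fin = finite_mult_of[OF assms(1)]
  obtain g where g: "g \<in> carrier (mult_of R)" "carrier (mult_of R) = {g [^] i | i::nat. i \<in> UNIV}"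
    using finite_field_mult_group_has_gen[OF assms(1)] by blast
  \<comment> \<open>The powers of g with exponents below its order are distinct and exhaust the
    group.\<close>
  have ord_g: "M.ord g = Coset.order (mult_of R)"
  proof -
    have "carrier (mult_of R) = (\<lambda>i. g [^] i) ` {0..M.ord g - 1}"
      using g M.ord_elems[OF fin g(1)] by (auto simp: nat_pow_mult_of)
    hence "Coset.order (mult_of R) = card {0..M.ord g - 1}"
      using M.ord_inj[OF g(1)] by (simp add: Coset.order_def card_image nat_pow_mult_of)
    thus ?thesis using M.ord_ge_1[OF fin g(1)] by simp
  qed
  have "card H dvd Coset.order (mult_of R)"
    using M.lagrange[OF assms(2)] by (metis dvd_triv_right)
  then obtain m where m: "Coset.order (mult_of R) = card H * m" ..
  have "Coset.order (mult_of R) \<noteq> 0"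
    using fin M.order_gt_0_iff_finite by blast
  hence "m \<noteq> 0" "card H \<noteq> 0" using m by auto
  define z where "z = g [^]\<^bsub>mult_of R\<^esub> m"
  have zc: "z \<in> carrier (mult_of R)" unfolding z_def using g(1) by (rule M.nat_pow_closed)
  have "M.ord z = card H"
    unfolding z_def using M.ord_pow[OF g(1), of m] m ord_g \<open>m \<noteq> 0\<close> by simp
  hence *: "z [^] n = \<one> \<longleftrightarrow> card H dvd n" for n :: nat
    using M.pow_eq_id[OF zc, of n] by (simp add: nat_pow_mult_of)
  have "z \<in> H"
    using zc * by (subst finite_subgroup_eq_roots[OF assms]) auto
  from this * show ?thesis by (rule that)
qed

text \<open>The first \<open>card H\<close> powers of z are distinct and lie in \<open>H\<close>, so
  by counting they are all of \<open>H\<close>.\<close>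

lemma (in field) primitive_root_generates:
  assumes "finite (carrier R)" "subgroup H (mult_of R)"
    and "z \<in> H" "\<And>n::nat. z [^] n = \<one> \<longleftrightarrow> card H dvd n" and "x \<in> H"
  obtains n :: nat where "x = z [^] n"
proof -
  interpret M: group "mult_of R" by (rule field_mult_group)
  have sub: "H \<subseteq> carrier (mult_of R)" using subgroup.subset[OF assms(2)] .
  hence "finite H" using finite_mult_of[OF assms(1)] finite_subset by blast
  have zc: "z \<in> carrier (mult_of R)" using assms(3) sub by blast
  have "M.ord z = card H"
    using assms(4) M.pow_eq_id[OF zc] by (metis dvd_antisym dvd_refl nat_pow_mult_of one_mult_of)
  moreover have "M.ord z \<ge> 1"
    by (rule M.ord_ge_1[OF finite_mult_of[OF assms(1)] zc])
  ultimately have "card ((\<lambda>i::nat. z [^] i) ` {0..M.ord z - 1}) = card H"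
    using M.ord_inj[OF zc] by (simp add: card_image nat_pow_mult_of)
  moreover have "z [^] i \<in> H" for i :: nat
    using assms(3)
    by (induction i) (auto intro: subgroup.m_closed[OF assms(2), simplified] subgroup.one_closed[OF assms(2), simplified])
  ultimately have "(\<lambda>i::nat. z [^] i) ` {0..M.ord z - 1} = H"
    using \<open>finite H\<close> by (intro card_subset_eq) auto
  thus ?thesis using assms(5) that by blast
qed

text \<open>Reducing modulo \<open>X^k - 1\<close> leaves a remainder of degree below \<open>k\<close> with \<open>k\<close> roots in \<open>F\<close>, so all
  its coefficients are divisible by \<open>p\<close>.\<close>

lemma ipoly_vanishing_transfer:
  fixes F :: "('a, 'm) ring_scheme" and E :: "('b, 'n) ring_scheme"
  assumes "field F" "finite (carrier F)" "card (carrier F) = p ^ r" "Factorial_Ring.prime p"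
    and "field E" "finite (carrier E)" "card (carrier E) = p ^ s"
    and "\<Phi> \<subseteq> carrier F" "card \<Phi> = k" "k > 0"
    and z: "z \<in> carrier E" "z [^]\<^bsub>E\<^esub> k = \<one>\<^bsub>E\<^esub>"
    and roots: "\<And>x. x \<in> \<Phi> \<Longrightarrow> x [^]\<^bsub>F\<^esub> k = \<one>\<^bsub>F\<^esub>"
    and van: "\<And>x. x \<in> \<Phi> \<Longrightarrow> domain.ipoly F P x = \<zero>\<^bsub>F\<^esub>"
  shows "domain.ipoly E P z = \<zero>\<^bsub>E\<^esub>"
proof -
  interpret F: field F by fact
  interpret E: field E by fact
  define g :: "int poly" where "g = Polynomial.monom 1 k - 1"
  have deg_g: "degree g = k" and lc_g: "Polynomial.coeff g k = 1"
  proof -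
    have c: "Polynomial.coeff g k = 1" using \<open>k > 0\<close> by (simp add: g_def)
    moreover have "degree g \<le> k"
      unfolding g_def by (rule degree_diff_le) (auto simp: degree_monom_eq)
    ultimately show "degree g = k" by (simp add: le_antisym le_degree)
    show "Polynomial.coeff g k = 1" by (rule c)
  qed
  have "g \<noteq> 0" using lc_g by auto
  \<comment> \<open>Since \<open>g\<close> is monic, pseudo-division scales \<open>P\<close> only by
    a power of 1, so it is true division with remainder over the integers.\<close>
  obtain Q R where QR: "pseudo_divmod P g = (Q, R)" by force
  have P: "P = g * Q + R" and R: "R = 0 \<or> degree R < k"
    using pseudo_divmod[OF \<open>g \<noteq> 0\<close> QR] deg_g lc_g by auto
  have R0: "F.ipoly R x = \<zero>\<^bsub>F\<^esub>" if "x \<in> \<Phi>" for x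
  proof -
    have x: "x \<in> carrier F" using that \<open>\<Phi> \<subseteq> carrier F\<close> by blast
    have "F.ipoly g x = \<zero>\<^bsub>F\<^esub>"
      using x roots[OF that] by (simp add: g_def F.ipoly_diff F.ipoly_monom F.ipoly_1)
    thus ?thesis
      using van[OF that] x by (simp add: P F.ipoly_add F.ipoly_mult)
  qed
  have "F.int_emb (Polynomial.coeff R i) = \<zero>\<^bsub>F\<^esub>" for i
    using R F.int_emb_coeff_eq_0_if_many_roots[OF assms(2,8) R0] \<open>card \<Phi> = k\<close> by auto
  \<comment> \<open>Vanishing in either field means divisibility of the coefficient by the common
    characteristic \<open>p\<close>.\<close>
  hence "E.int_emb (Polynomial.coeff R i) = \<zero>\<^bsub>E\<^esub>" for i
    using F.int_emb_eq_0_iff[OF assms(2,3,4)] E.int_emb_eq_0_iff[OF assms(6,7,4)] by simp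
  hence "E.ipoly R z = \<zero>\<^bsub>E\<^esub>"
    using z(1) by (rule E.ipoly_eq_0_if_coeffs)
  moreover have "E.ipoly g z = \<zero>\<^bsub>E\<^esub>"
    using z by (simp add: g_def E.ipoly_diff E.ipoly_monom E.ipoly_1)
  ultimately show ?thesis
    using z(1) by (simp add: P E.ipoly_add E.ipoly_mult)
qed

text \<open>This plays the role of an embedding of \<open>GF(p)(z)\<close> into \<open>F\<close>. If every \<open>y\<close> had a polynomial \<open>f y\<close>
  vanishing at \<open>y\<close> but not at \<open>z\<close>, the product of the \<open>f y\<close> would vanish on \<open>\<Phi>\<close>, hence at \<open>z\<close>.\<close>

lemma exists_root_with_fewer_relations:
  fixes F :: "('a, 'm) ring_scheme" and E :: "('b, 'n) ring_scheme"
  assumes "field F" "finite (carrier F)" "card (carrier F) = p ^ r" "Factorial_Ring.prime p"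
    and "field E" "finite (carrier E)" "card (carrier E) = p ^ s"
    and "\<Phi> \<subseteq> carrier F" "card \<Phi> = k" "k > 0"
    and z: "z \<in> carrier E" "z [^]\<^bsub>E\<^esub> k = \<one>\<^bsub>E\<^esub>"
    and roots: "\<And>x. x \<in> \<Phi> \<Longrightarrow> x [^]\<^bsub>F\<^esub> k = \<one>\<^bsub>F\<^esub>"
  obtains y where "y \<in> \<Phi>"
    "\<And>P. domain.ipoly F P y = \<zero>\<^bsub>F\<^esub> \<Longrightarrow> domain.ipoly E P z = \<zero>\<^bsub>E\<^esub>"
proof -
  interpret F: field F by fact
  interpret E: field E by fact
  have "\<exists>y\<in>\<Phi>. \<forall>P. F.ipoly P y = \<zero>\<^bsub>F\<^esub> \<longrightarrow> E.ipoly P z = \<zero>\<^bsub>E\<^esub>"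
  proof (rule ccontr)
    assume "\<not> ?thesis"
    then obtain f where f: "\<And>y. y \<in> \<Phi> \<Longrightarrow> F.ipoly (f y) y = \<zero>\<^bsub>F\<^esub>"
      "\<And>y. y \<in> \<Phi> \<Longrightarrow> E.ipoly (f y) z \<noteq> \<zero>\<^bsub>E\<^esub>"
      by metis
    have fin: "finite \<Phi>" using assms(2,8) finite_subset by blast
    have "F.ipoly (\<Prod>y\<in>\<Phi>. f y) x = \<zero>\<^bsub>F\<^esub>" if "x \<in> \<Phi>" for x
      using that fin f(1)[OF that] assms(8)
      by (subst prod.remove[OF fin that]) (auto simp: F.ipoly_mult)
    hence "E.ipoly (\<Prod>y\<in>\<Phi>. f y) z = \<zero>\<^bsub>E\<^esub>"
      using assms by (intro ipoly_vanishing_transfer[of F p r E s \<Phi> k z]) auto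
    thus False
      using E.ipoly_prod_eq_0[OF z(1) fin] f(2) by blast
  qed
  thus ?thesis using that by blast
qed

subsection \<open>Circularity depends only on the characteristic and the order\<close>

lemma mem_scaled_translate:
  "y \<in> scaled_translate F \<Phi> b c \<longleftrightarrow> (\<exists>h\<in>\<Phi>. y = h \<otimes>\<^bsub>F\<^esub> b \<oplus>\<^bsub>F\<^esub> c)"
  by (auto simp: scaled_translate_def r_coset_def a_r_coset_def')

context field begin

text \<open>Subtracting the equations gives (xi - xj) a = (yi - yj) b. Multiplied by a b, both sides
  become the same product of differences, and a b can be cancelled.\<close>

lemma affine_points_relation:
  assumes [simp]: "a \<in> carrier R" "b \<in> carrier R" "c \<in> carrier R"
    "x1 \<in> carrier R" "x2 \<in> carrier R" "x3 \<in> carrier R"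
    "y1 \<in> carrier R" "y2 \<in> carrier R" "y3 \<in> carrier R"
    and nz: "a \<noteq> \<zero>" "b \<noteq> \<zero>"
    and eq: "x1 \<otimes> a = y1 \<otimes> b \<oplus> c" "x2 \<otimes> a = y2 \<otimes> b \<oplus> c" "x3 \<otimes> a = y3 \<otimes> b \<oplus> c"
  shows "(x1 \<ominus> x2) \<otimes> (y1 \<ominus> y3) = (x1 \<ominus> x3) \<otimes> (y1 \<ominus> y2)"
proof -
  have "(x1 \<ominus> x2) \<otimes> (y1 \<ominus> y3) \<otimes> (a \<otimes> b) = (x1 \<otimes> a \<ominus> x2 \<otimes> a) \<otimes> (y1 \<otimes> b \<ominus> y3 \<otimes> b)"
    by (insert assms(1-9), algebra)
  also have "\<dots> = (x1 \<otimes> a \<ominus> x3 \<otimes> a) \<otimes> (y1 \<otimes> b \<ominus> y2 \<otimes> b)"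
    unfolding eq by (insert assms(1-9), algebra)
  also have "\<dots> = (x1 \<ominus> x3) \<otimes> (y1 \<ominus> y2) \<otimes> (a \<otimes> b)"
    by (insert assms(1-9), algebra)
  finally show ?thesis
    using nz by (simp add: m_rcancel integral_iff)
qed

text \<open>Take x1 times the second equation minus x2 times the first: the left side cancels,
  proportionality removes the b term, and (x1 - x2) c = 0 remains.\<close>

lemma affine_points_proportional_imp:
  assumes [simp]: "a \<in> carrier R" "b \<in> carrier R" "c \<in> carrier R"
    "x1 \<in> carrier R" "x2 \<in> carrier R" "y1 \<in> carrier R" "y2 \<in> carrier R"
    and nz: "a \<noteq> \<zero>" "x1 \<noteq> x2"
    and eq: "x1 \<otimes> a = y1 \<otimes> b \<oplus> c" "x2 \<otimes> a = y2 \<otimes> b \<oplus> c"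
    and pr: "x1 \<otimes> y2 = x2 \<otimes> y1"
  shows "c = \<zero>"
proof -
  have "(x1 \<ominus> x2) \<otimes> c = x1 \<otimes> (y2 \<otimes> b \<oplus> c) \<ominus> x2 \<otimes> (y1 \<otimes> b \<oplus> c) \<ominus> (x1 \<otimes> y2 \<ominus> x2 \<otimes> y1) \<otimes> b"
    by (insert assms(1-7), algebra)
  also have "\<dots> = x1 \<otimes> (x2 \<otimes> a) \<ominus> x2 \<otimes> (x1 \<otimes> a)"
    unfolding eq pr by (insert assms(1-7), algebra)
  also have "\<dots> = \<zero>"
    by (insert assms(1-7), algebra)
  finally show ?thesis using nz by (simp add: integral_iff)
qed

text \<open>Eliminating the centre and the radius from three points of an intersection leaves an
  equation between elements of \<open>H\<close> alone; the proportional solutions belong to centre \<open>0\<close>.\<close>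

lemma circular_iff_relation:
  assumes fin: "finite (carrier R)" and H: "subgroup H (mult_of R)"
  shows "circular R H \<longleftrightarrow>
    (\<forall>x1\<in>H. \<forall>x2\<in>H. \<forall>x3\<in>H. \<forall>y1\<in>H. \<forall>y2\<in>H. \<forall>y3\<in>H.
       distinct [x1, x2, x3] \<and> distinct [y1, y2, y3] \<and>
       (x1 \<ominus> x2) \<otimes> (y1 \<ominus> y3) = (x1 \<ominus> x3) \<otimes> (y1 \<ominus> y2) \<longrightarrow> x1 \<otimes> y2 = x2 \<otimes> y1)"
    (is "_ = ?rel")
proof -
  have sub: "x \<in> carrier R" "x \<noteq> \<zero>" if "x \<in> H" for x
    using subgroup.subset[OF H] that by auto
  have finH: "finite H" using fin sub by (meson finite_subset subsetI)
  have H1: "H #> \<one> = H" using sub by (force simp: r_coset_def)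
  show ?thesis
  proof
    assume circ: "circular R H"
    show ?rel
    proof (intro ballI impI, elim conjE, rule ccontr)
      fix x1 x2 x3 y1 y2 y3
      assume mem: "x1 \<in> H" "x2 \<in> H" "x3 \<in> H" "y1 \<in> H" "y2 \<in> H" "y3 \<in> H"
        and dx: "distinct [x1, x2, x3]" and dy: "distinct [y1, y2, y3]"
        and rel: "(x1 \<ominus> x2) \<otimes> (y1 \<ominus> y3) = (x1 \<ominus> x3) \<otimes> (y1 \<ominus> y2)"
        and np: "x1 \<otimes> y2 \<noteq> x2 \<otimes> y1"
      note c = mem[THEN sub(1)]
      define d where "d = y1 \<ominus> y2"
      have d: "d \<in> carrier R" "d \<noteq> \<zero>" using c dy by (auto simp: d_def)
      hence invd: "inv d \<in> carrier R" "d \<otimes> inv d = \<one>"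
        by (auto simp: field_Units)
      hence "inv d \<noteq> \<zero>" using d by auto
      \<comment> \<open>The affine map y -> y b + e is chosen to send y1 to x1 and y2 to x2;
        \<open>rel\<close> then forces it to send y3 to x3.\<close>
      define b where "b = (x1 \<ominus> x2) \<otimes> inv d"
      define e where "e = x1 \<ominus> y1 \<otimes> b"
      have b: "b \<in> carrier R" "b \<noteq> \<zero>" and e: "e \<in> carrier R"
        using c dx invd \<open>inv d \<noteq> \<zero>\<close> by (auto simp: b_def e_def integral_iff)
      have bd: "(y1 \<ominus> y2) \<otimes> b = x1 \<ominus> x2" "(y1 \<ominus> y3) \<otimes> b = x1 \<ominus> x3"
      proof -
        have "(y1 \<ominus> y2) \<otimes> b = (x1 \<ominus> x2) \<otimes> (d \<otimes> inv d)"
          unfolding b_def d_def[symmetric] by (insert c d invd(1), algebra)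
        thus "(y1 \<ominus> y2) \<otimes> b = x1 \<ominus> x2" using c invd by simp
        have "(y1 \<ominus> y3) \<otimes> b = ((x1 \<ominus> x2) \<otimes> (y1 \<ominus> y3)) \<otimes> inv d"
          unfolding b_def by (insert c d invd(1), algebra)
        also have "\<dots> = (x1 \<ominus> x3) \<otimes> (d \<otimes> inv d)"
          unfolding rel d_def[symmetric] by (insert c d invd(1), algebra)
        finally show "(y1 \<ominus> y3) \<otimes> b = x1 \<ominus> x3" using c invd by simp
      qed
      have pts: "x1 = y1 \<otimes> b \<oplus> e" "x2 = y2 \<otimes> b \<oplus> e" "x3 = y3 \<otimes> b \<oplus> e"
      proof -
        show "x1 = y1 \<otimes> b \<oplus> e" unfolding e_def by (insert c b(1), algebra)
        have "y2 \<otimes> b \<oplus> e = x1 \<ominus> (y1 \<ominus> y2) \<otimes> b" unfolding e_def by (insert c b(1), algebra)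
        also have "\<dots> = x2" unfolding bd by (insert c b(1), algebra)
        finally show "x2 = y2 \<otimes> b \<oplus> e" ..
        have "y3 \<otimes> b \<oplus> e = x1 \<ominus> (y1 \<ominus> y3) \<otimes> b" unfolding e_def by (insert c b(1), algebra)
        also have "\<dots> = x3" unfolding bd by (insert c b(1), algebra)
        finally show "x3 = y3 \<otimes> b \<oplus> e" ..
      qed
      \<comment> \<open>Circularity speaks only of nonzero centres. Centre 0 would make the points
        proportional, against \<open>np\<close>.\<close>
      have "e \<noteq> \<zero>"
      proof
        assume "e = \<zero>"
        hence "x1 = y1 \<otimes> b" "x2 = y2 \<otimes> b" using pts c b by auto
        hence "x1 \<otimes> y2 = x2 \<otimes> y1" using c b(1) by (simp add: m_ac)
        with np show False by simp
      qed
      hence le: "card ((H #> \<one>) \<inter> scaled_translate R H b e) \<le> 2"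
        using circ b e by (simp add: circular_def)
      have "{x1, x2, x3} \<subseteq> (H #> \<one>) \<inter> scaled_translate R H b e"
        using mem pts by (auto simp: mem_scaled_translate H1)
      hence "card {x1, x2, x3} \<le> card ((H #> \<one>) \<inter> scaled_translate R H b e)"
        using finH by (intro card_mono) (auto simp: r_coset_def)
      with le dx show False by simp
    qed
  next
    assume rel: ?rel
    show "circular R H"
      unfolding circular_def
    proof (intro ballI, rule ccontr)
      fix a b c
      assume abc: "a \<in> carrier (mult_of R)" "b \<in> carrier (mult_of R)" "c \<in> carrier (mult_of R)"
        and "\<not> card ((H #> a) \<inter> scaled_translate R H b c) \<le> 2"
      then obtain T where T: "T \<subseteq> (H #> a) \<inter> scaled_translate R H b c" "card T = 3"
        by (metis not_less_eq_eq numeral_2_eq_2 numeral_3_eq_3 obtain_subset_with_card_n)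
      then obtain u v w where uvw: "distinct [u, v, w]" "u \<in> T" "v \<in> T" "w \<in> T"
        by (auto simp: card_3_iff)
      have *: "\<exists>x\<in>H. \<exists>y\<in>H. t = x \<otimes> a \<and> t = y \<otimes> b \<oplus> c" if "t \<in> T" for t
        using that T(1) by (fastforce simp: mem_scaled_translate r_coset_def)
      from *[OF uvw(2)] obtain x1 y1 where 1: "x1 \<in> H" "y1 \<in> H" "u = x1 \<otimes> a" "x1 \<otimes> a = y1 \<otimes> b \<oplus> c"
        by auto
      from *[OF uvw(3)] obtain x2 y2 where 2: "x2 \<in> H" "y2 \<in> H" "v = x2 \<otimes> a" "x2 \<otimes> a = y2 \<otimes> b \<oplus> c"
        by auto
      from *[OF uvw(4)] obtain x3 y3 where 3: "x3 \<in> H" "y3 \<in> H" "w = x3 \<otimes> a" "x3 \<otimes> a = y3 \<otimes> b \<oplus> c"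
        by auto
      have abc': "a \<in> carrier R" "b \<in> carrier R" "c \<in> carrier R" "a \<noteq> \<zero>" "b \<noteq> \<zero>" "c \<noteq> \<zero>"
        using abc by auto
      note cl = 1(1,2)[THEN sub(1)] 2(1,2)[THEN sub(1)] 3(1,2)[THEN sub(1)]
      have dx: "distinct [x1, x2, x3]" using uvw(1) 1(3) 2(3) 3(3) by auto
      have dy: "distinct [y1, y2, y3]" using uvw(1) 1(3,4) 2(3,4) 3(3,4) by auto
      have "(x1 \<ominus> x2) \<otimes> (y1 \<ominus> y3) = (x1 \<ominus> x3) \<otimes> (y1 \<ominus> y2)"
        using affine_points_relation[of a b c x1 x2 x3 y1 y2 y3] abc' cl 1(4) 2(4) 3(4) by blast
      hence "x1 \<otimes> y2 = x2 \<otimes> y1"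
        using rel 1(1,2) 2(1,2) 3(1,2) dx dy by blast
      hence "c = \<zero>"
        using affine_points_proportional_imp[of a b c x1 x2 y1 y2] abc' cl 1(4) 2(4) dx by simp
      thus False using abc' by simp
    qed
  qed
qed

end

text \<open>Write the elements of \<open>H\<close> as powers of a generator y whose integer
  relations all hold for a generator z of \<open>K\<close>. A relation among six points of
  \<open>H\<close> then holds in \<open>K\<close>, circularity there yields an equality of two
  powers of z, and such equalities return to y because both generators have the same order.\<close>

theorem circular_transfer:
  fixes F :: "('a, 'm) ring_scheme" and E :: "('b, 'n) ring_scheme"
  assumes "field F" "finite (carrier F)" "card (carrier F) = p ^ r" "Factorial_Ring.prime p"
    and "field E" "finite (carrier E)" "card (carrier E) = p ^ s"
    and H: "subgroup H (mult_of F)" and K: "subgroup K (mult_of E)" and "card H = card K"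
    and circ: "circular E K"
  shows "circular F H"
proof -
  interpret F: field F by fact
  interpret E: field E by fact
  have subH: "H \<subseteq> carrier F" using subgroup.subset[OF H] by auto
  have subK: "K \<subseteq> carrier E" using subgroup.subset[OF K] by auto
  have rootsH: "x [^]\<^bsub>F\<^esub> card K = \<one>\<^bsub>F\<^esub>" if "x \<in> H" for x
    using that F.finite_subgroup_eq_roots[OF assms(2) H] \<open>card H = card K\<close> by auto
  have "K \<noteq> {}" using subgroup.one_closed[OF K] by auto
  hence "card K > 0" using finite_subset[OF subK assms(6)] by (simp add: card_gt_0_iff)
  obtain z where z: "z \<in> K" "\<And>n::nat. z [^]\<^bsub>E\<^esub> n = \<one>\<^bsub>E\<^esub> \<longleftrightarrow> card K dvd n"
    using E.finite_subgroup_primitive_root[OF assms(6) K] by blast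
  have zE: "z \<in> carrier E" using z(1) subK by blast
  have zK: "z [^]\<^bsub>E\<^esub> card K = \<one>\<^bsub>E\<^esub>" using z(2) by simp
  obtain y where y: "y \<in> H"
    "\<And>P. F.ipoly P y = \<zero>\<^bsub>F\<^esub> \<Longrightarrow> E.ipoly P z = \<zero>\<^bsub>E\<^esub>"
    using exists_root_with_fewer_relations[OF assms(1-7) subH \<open>card H = card K\<close>
        \<open>card K > 0\<close> zE zK rootsH] by metis
  have yF: "y \<in> carrier F" using y(1) subH by blast
  define X :: "nat \<Rightarrow> int poly" where "X = Polynomial.monom 1"
  have XF: "F.ipoly (X n) y = y [^]\<^bsub>F\<^esub> n" and XE: "E.ipoly (X n) z = z [^]\<^bsub>E\<^esub> n" for n
    using yF zE by (simp_all add: X_def F.ipoly_monom E.ipoly_monom)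
  note polyF = F.ipoly_diff[OF yF] F.ipoly_mult[OF yF] F.ipoly_closed[OF yF]
  note polyE = E.ipoly_diff[OF zE] E.ipoly_mult[OF zE] E.ipoly_closed[OF zE]
  have eqE: "E.ipoly P z = E.ipoly Q z" if "F.ipoly P y = F.ipoly Q y" for P Q
  proof -
    have "F.ipoly (P - Q) y = \<zero>\<^bsub>F\<^esub>" using that polyF by simp
    hence "E.ipoly (P - Q) z = \<zero>\<^bsub>E\<^esub>" by (rule y(2))
    thus ?thesis using polyE by simp
  qed
  \<comment> \<open>If y^n = 1, this relation passes to z, whose order is known, so y is itself
    primitive.\<close>
  have y_pow: "y [^]\<^bsub>F\<^esub> n = \<one>\<^bsub>F\<^esub> \<longleftrightarrow> card H dvd n" for n :: nat
  proof
    assume "y [^]\<^bsub>F\<^esub> n = \<one>\<^bsub>F\<^esub>"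
    hence "F.ipoly (X n) y = F.ipoly (X 0) y" using XF by simp
    hence "E.ipoly (X n) z = E.ipoly (X 0) z" by (rule eqE)
    thus "card H dvd n" using XE z(2) \<open>card H = card K\<close> by simp
  next
    assume "card H dvd n"
    then obtain m where "n = card K * m" using \<open>card H = card K\<close> by auto
    thus "y [^]\<^bsub>F\<^esub> n = \<one>\<^bsub>F\<^esub>"
      using rootsH[OF y(1)] yF by (simp flip: F.nat_pow_pow)
  qed
  have zpow: "z [^]\<^bsub>E\<^esub> n \<in> K" for n :: nat
    using z(1) subgroup.one_closed[OF K] subgroup.m_closed[OF K]
    by (induction n) auto
  \<comment> \<open>General relations pass only from y to z; equalities of powers also go
    back.\<close>
  have eqF: "y [^]\<^bsub>F\<^esub> i = y [^]\<^bsub>F\<^esub> j" if "z [^]\<^bsub>E\<^esub> i = z [^]\<^bsub>E\<^esub> j" for i j :: nat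
    using that
  proof (induction i j rule: linorder_wlog)
    case (le i j)
    have yi: "y [^]\<^bsub>F\<^esub> i \<in> carrier F" by (simp add: yF)
    have zi: "z [^]\<^bsub>E\<^esub> i \<in> carrier E" "z [^]\<^bsub>E\<^esub> i \<noteq> \<zero>\<^bsub>E\<^esub>"
      using zpow[of i] subgroup.subset[OF K] by auto
    have "z [^]\<^bsub>E\<^esub> i \<otimes>\<^bsub>E\<^esub> z [^]\<^bsub>E\<^esub> (j - i) = z [^]\<^bsub>E\<^esub> (i + (j - i))"
      using zE by (rule E.nat_pow_mult)
    also have "\<dots> = z [^]\<^bsub>E\<^esub> i \<otimes>\<^bsub>E\<^esub> \<one>\<^bsub>E\<^esub>"
      using le zi by simp
    finally have "z [^]\<^bsub>E\<^esub> i \<otimes>\<^bsub>E\<^esub> z [^]\<^bsub>E\<^esub> (j - i) = z [^]\<^bsub>E\<^esub> i \<otimes>\<^bsub>E\<^esub> \<one>\<^bsub>E\<^esub>" .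
    hence "z [^]\<^bsub>E\<^esub> (j - i) = \<one>\<^bsub>E\<^esub>"
      using zi zE by (subst (asm) E.m_lcancel) auto
    hence "y [^]\<^bsub>F\<^esub> (j - i) = \<one>\<^bsub>F\<^esub>"
      using z(2) y_pow \<open>card H = card K\<close> by simp
    hence "y [^]\<^bsub>F\<^esub> i \<otimes>\<^bsub>F\<^esub> y [^]\<^bsub>F\<^esub> (j - i) = y [^]\<^bsub>F\<^esub> i"
      using yi by simp
    thus ?case using le yF by (simp add: F.nat_pow_mult)
  qed simp
  have gen: "\<exists>n::nat. x = y [^]\<^bsub>F\<^esub> n" if "x \<in> H" for x
    using F.primitive_root_generates[OF assms(2) H y(1) y_pow that] by blast
  show ?thesis
    unfolding F.circular_iff_relation[OF assms(2) H]
  proof (intro ballI impI, elim conjE)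
    fix x1 x2 x3 y1 y2 y3
    assume mem: "x1 \<in> H" "x2 \<in> H" "x3 \<in> H" "y1 \<in> H" "y2 \<in> H" "y3 \<in> H"
      and dx: "distinct [x1, x2, x3]" and dy: "distinct [y1, y2, y3]"
      and rel: "(x1 \<ominus>\<^bsub>F\<^esub> x2) \<otimes>\<^bsub>F\<^esub> (y1 \<ominus>\<^bsub>F\<^esub> y3) = (x1 \<ominus>\<^bsub>F\<^esub> x3) \<otimes>\<^bsub>F\<^esub> (y1 \<ominus>\<^bsub>F\<^esub> y2)"
    obtain i1 i2 i3 j1 j2 j3 :: nat where
      x: "x1 = y [^]\<^bsub>F\<^esub> i1" "x2 = y [^]\<^bsub>F\<^esub> i2" "x3 = y [^]\<^bsub>F\<^esub> i3" and
      ys: "y1 = y [^]\<^bsub>F\<^esub> j1" "y2 = y [^]\<^bsub>F\<^esub> j2" "y3 = y [^]\<^bsub>F\<^esub> j3"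
      using mem[THEN gen] by blast
    have "F.ipoly ((X i1 - X i2) * (X j1 - X j3)) y = F.ipoly ((X i1 - X i3) * (X j1 - X j2)) y"
      using rel polyF XF x ys by simp
    hence relE: "(z [^]\<^bsub>E\<^esub> i1 \<ominus>\<^bsub>E\<^esub> z [^]\<^bsub>E\<^esub> i2) \<otimes>\<^bsub>E\<^esub> (z [^]\<^bsub>E\<^esub> j1 \<ominus>\<^bsub>E\<^esub> z [^]\<^bsub>E\<^esub> j3) =
      (z [^]\<^bsub>E\<^esub> i1 \<ominus>\<^bsub>E\<^esub> z [^]\<^bsub>E\<^esub> i3) \<otimes>\<^bsub>E\<^esub> (z [^]\<^bsub>E\<^esub> j1 \<ominus>\<^bsub>E\<^esub> z [^]\<^bsub>E\<^esub> j2)"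
      using eqE polyE XE by metis
    \<comment> \<open>Distinctness passes to \<open>E\<close> by the contrapositive of
      \<open>eqF\<close>.\<close>
    have "distinct [z [^]\<^bsub>E\<^esub> i1, z [^]\<^bsub>E\<^esub> i2, z [^]\<^bsub>E\<^esub> i3]"
         "distinct [z [^]\<^bsub>E\<^esub> j1, z [^]\<^bsub>E\<^esub> j2, z [^]\<^bsub>E\<^esub> j3]"
      using dx dy unfolding x ys by (auto dest: eqF)
    hence "z [^]\<^bsub>E\<^esub> i1 \<otimes>\<^bsub>E\<^esub> z [^]\<^bsub>E\<^esub> j2 = z [^]\<^bsub>E\<^esub> i2 \<otimes>\<^bsub>E\<^esub> z [^]\<^bsub>E\<^esub> j1"
      using circ relE zpow unfolding E.circular_iff_relation[OF assms(6) K] by blast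
    hence "z [^]\<^bsub>E\<^esub> (i1 + j2) = z [^]\<^bsub>E\<^esub> (i2 + j1)"
      using zE by (simp add: E.nat_pow_mult)
    hence "y [^]\<^bsub>F\<^esub> (i1 + j2) = y [^]\<^bsub>F\<^esub> (i2 + j1)" by (rule eqF)
    thus "x1 \<otimes>\<^bsub>F\<^esub> y2 = x2 \<otimes>\<^bsub>F\<^esub> y1"
      using yF by (simp add: x ys F.nat_pow_mult)
  qed
qed

subsection \<open>Counting the points of the bracket\<close>

context
  fixes R :: "('a, 'm) ring_scheme" (structure) and H a
  assumes field: "field R" and fin: "finite (carrier R)" and H: "subgroup H (mult_of R)"
    and a: "a \<in> carrier R" "a \<noteq> \<zero>"
begin

interpretation field R by (rule field)

lemma mem_subgroup:
  assumes "x \<in> H"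
  shows "x \<in> carrier R" "x \<noteq> \<zero>"
  using subgroup.subset[OF H] assms by auto

lemma mult_mem_subgroup: "x \<in> H \<Longrightarrow> y \<in> H \<Longrightarrow> x \<otimes> y \<in> H"
  using subgroup.m_closed[OF H] by simp

lemma inverse_in_subgroup:
  assumes "x \<in> H"
  obtains y where "y \<in> H" "x \<otimes> y = \<one>" "y \<otimes> x = \<one>"
proof -
  interpret M: group "mult_of R" by (rule field_mult_group)
  have x: "x \<in> carrier (mult_of R)" using subgroup.subset[OF H] assms by blast
  show ?thesis
    using that[OF subgroup.m_inv_closed[OF H assms]] M.r_inv[OF x] M.l_inv[OF x] by simp
qed

text \<open>The equation x = h a + 1 can be solved as a = h^(-1) (x - 1), and a \<noteq> 0 excludes
  x = 1. This turns the points counted by the bracket into the \<psi> of the case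
  conditions.\<close>

lemma mem_translate_iff:
  "x \<in> H \<inter> scaled_translate R H a \<one> \<longleftrightarrow> x \<in> H \<and> x \<noteq> \<one> \<and> a \<in> H #> (x \<ominus> \<one>)"
    (is "?L \<longleftrightarrow> ?R")
proof
  assume ?L
  hence x: "x \<in> H" "x \<in> scaled_translate R H a \<one>" by auto
  note xc = mem_subgroup[OF x(1)]
  obtain h where h: "h \<in> H" "x = h \<otimes> a \<oplus> \<one>" using x(2) by (auto simp: mem_scaled_translate)
  note hc = mem_subgroup[OF h(1)]
  obtain h' where h': "h' \<in> H" "h' \<otimes> h = \<one>" using h(1) inverse_in_subgroup by blast
  note h'c = mem_subgroup[OF h'(1)]
  have "h' \<otimes> (x \<ominus> \<one>) = (h' \<otimes> h) \<otimes> a"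
    unfolding h(2) by (insert a(1) hc(1) h'c(1), algebra)
  hence "a = h' \<otimes> (x \<ominus> \<one>)" using a h' by simp
  hence "a \<in> H #> (x \<ominus> \<one>)" using h'(1) by (auto simp: r_coset_def)
  moreover have "x \<noteq> \<one>"
  proof
    assume "x = \<one>"
    have "h \<otimes> a = x \<ominus> \<one>" unfolding h(2) by (insert a(1) hc(1), algebra)
    hence "h \<otimes> a = \<zero>" using \<open>x = \<one>\<close> by simp
    thus False using hc a by (simp add: integral_iff)
  qed
  ultimately show ?R using x(1) by blast
next
  assume ?R
  hence x: "x \<in> H" "a \<in> H #> (x \<ominus> \<one>)" by auto
  note xc = mem_subgroup[OF x(1)]
  obtain h where h: "h \<in> H" "a = h \<otimes> (x \<ominus> \<one>)" using x(2) by (auto simp: r_coset_def)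
  note hc = mem_subgroup[OF h(1)]
  obtain h' where h': "h' \<in> H" "h' \<otimes> h = \<one>" using h(1) inverse_in_subgroup by blast
  note h'c = mem_subgroup[OF h'(1)]
  have "h' \<otimes> a \<oplus> \<one> = (h' \<otimes> h) \<otimes> (x \<ominus> \<one>) \<oplus> \<one>"
    unfolding h(2) by (insert xc(1) hc(1) h'c(1), algebra)
  also have "\<dots> = x" unfolding h'(2) by (insert xc(1), algebra)
  finally show ?L using h'(1) x(1) by (auto simp: mem_scaled_translate)
qed

text \<open>From a = g (x - 1) follows a = (-g x)(x^(-1) - 1), and -g x lies in \<open>H\<close>
  once -1 does.\<close>

lemma inverse_mem_translate:
  assumes m1: "\<ominus> \<one> \<in> H" and x: "x \<in> H \<inter> scaled_translate R H a \<one>"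
    and y: "y \<in> H" "x \<otimes> y = \<one>"
  shows "y \<in> H \<inter> scaled_translate R H a \<one>"
proof -
  have xH: "x \<in> H" "x \<noteq> \<one>" and "a \<in> H #> (x \<ominus> \<one>)" using x mem_translate_iff by blast+
  then obtain g where g: "g \<in> H" "a = g \<otimes> (x \<ominus> \<one>)" by (auto simp: r_coset_def)
  note c = mem_subgroup(1)[OF xH(1)] mem_subgroup(1)[OF y(1)] mem_subgroup(1)[OF g(1)]
  have "g \<otimes> x \<otimes> \<ominus> \<one> \<otimes> (y \<ominus> \<one>) = g \<otimes> (x \<ominus> x \<otimes> y)" by (insert c, algebra)
  hence "a = g \<otimes> x \<otimes> \<ominus> \<one> \<otimes> (y \<ominus> \<one>)" using g(2) y(2) by simp
  moreover have "g \<otimes> x \<otimes> \<ominus> \<one> \<in> H" using g xH m1 by (intro mult_mem_subgroup)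
  moreover have "y \<noteq> \<one>" using y xH c by auto
  ultimately show ?thesis
    using y(1) unfolding mem_translate_iff by (auto simp: r_coset_def)
qed

lemma square_eq_one_imp:
  assumes "x \<in> carrier R" "x \<otimes> x = \<one>"
  shows "x = \<one> \<or> x = \<ominus> \<one>"
proof -
  have "(x \<ominus> \<one>) \<otimes> (x \<oplus> \<one>) = x \<otimes> x \<ominus> \<one>" by (insert assms(1), algebra)
  also have "\<dots> = \<zero>" using assms by simp
  finally have "(x \<ominus> \<one>) \<otimes> (x \<oplus> \<one>) = \<zero>" .
  hence "x \<ominus> \<one> = \<zero> \<or> x \<oplus> \<one> = \<zero>" using assms by (simp add: integral_iff)
  thus ?thesis using assms(1) by (metis minus_equality add.inv_equality one_closed r_right_minus_eq)
qed

lemma finite_translate: "finite (H \<inter> scaled_translate R H a \<one>)"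
proof -
  have "H \<subseteq> carrier R" using mem_subgroup by blast
  thus ?thesis using fin finite_subset by blast
qed

lemma coset_by_one: "H #> \<one> = H"
  using mem_subgroup by (force simp: r_coset_def)

lemma bracket_le_2:
  assumes "circular R H"
  shows "bracket R H a \<one> \<le> 2"
proof -
  have "card ((H #> \<one>) \<inter> scaled_translate R H a \<one>) \<le> 2"
    using assms a by (simp add: circular_def)
  thus ?thesis by (simp add: bracket_def coset_by_one)
qed

text \<open>The inverse of x is a second point, different from x because x is neither 1 nor -1. In
  characteristic 2 this applies to every order, since there -1 = 1.\<close>

lemma bracket_eq_2:
  assumes "circular R H" "\<ominus> \<one> \<in> H"
    and x: "x \<in> H \<inter> scaled_translate R H a \<one>" "x \<noteq> \<ominus> \<one>"
  shows "bracket R H a \<one> = 2"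
proof -
  have xH: "x \<in> H" "x \<noteq> \<one>" using x mem_translate_iff by blast+
  obtain y where y: "y \<in> H" "x \<otimes> y = \<one>" using xH inverse_in_subgroup by blast
  have "y \<in> H \<inter> scaled_translate R H a \<one>"
    using assms(2) x(1) y by (rule inverse_mem_translate)
  moreover have "x \<noteq> y" using square_eq_one_imp[of x] y xH x(2) mem_subgroup by blast
  ultimately have "card {x, y} \<le> card (H \<inter> scaled_translate R H a \<one>)"
    using x finite_translate by (intro card_mono) auto
  thus ?thesis using bracket_le_2[OF assms(1)] \<open>x \<noteq> y\<close> by (simp add: bracket_def)
qed

text \<open>Any point other than -1 would bring along its inverse, giving three points together with
  -1.\<close>

lemma bracket_eq_1_even:
  assumes "circular R H" and m1: "\<ominus> \<one> \<in> H" "\<ominus> \<one> \<in> scaled_translate R H a \<one>"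
  shows "bracket R H a \<one> = 1"
proof -
  have "x = \<ominus> \<one>" if x: "x \<in> H \<inter> scaled_translate R H a \<one>" for x
  proof (rule ccontr)
    assume ne: "x \<noteq> \<ominus> \<one>"
    have xH: "x \<in> H" "x \<noteq> \<one>" using x mem_translate_iff by blast+
    obtain y where y: "y \<in> H" "x \<otimes> y = \<one>" using xH inverse_in_subgroup by blast
    note c = mem_subgroup(1)[OF xH(1)] mem_subgroup(1)[OF y(1)]
    have "y \<in> H \<inter> scaled_translate R H a \<one>"
      using m1(1) x y by (rule inverse_mem_translate)
    moreover have "x \<noteq> y" using square_eq_one_imp[of x] y xH ne c by blast
    moreover have "y \<noteq> \<ominus> \<one>"
    proof
      assume "y = \<ominus> \<one>"
      hence "x \<otimes> \<ominus> \<one> = \<one>" using y by simp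
      hence "\<ominus> x = \<one>" using c by (simp add: r_minus)
      thus False using ne c by (metis minus_minus)
    qed
    ultimately have "card {x, y, \<ominus> \<one>} \<le> bracket R H a \<one>"
      unfolding bracket_def using x m1 finite_translate by (intro card_mono) auto
    thus False using bracket_le_2[OF assms(1)] \<open>x \<noteq> y\<close> \<open>y \<noteq> \<ominus> \<one>\<close> ne by simp
  qed
  hence "H \<inter> scaled_translate R H a \<one> = {\<ominus> \<one>}" using m1 by blast
  thus ?thesis by (simp add: bracket_def)
qed

text \<open>Two points \<open>x = s a + 1\<close> and \<open>y = t a + 1\<close> of the bracket give, with \<open>w = s / t\<close>, the relation
  \<open>1 + w y = x + w = e\<close>, so \<open>1\<close>, \<open>w y\<close>, \<open>x\<close>, \<open>w\<close> all lie on the circle \<open>e - H\<close>.\<close>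

lemma bracket_eq_1_odd:
  assumes circ: "circular R H" and m1: "\<ominus> \<one> \<notin> H" and two: "\<one> \<oplus> \<one> \<noteq> \<zero>"
    and x: "x \<in> H \<inter> scaled_translate R H a \<one>"
  shows "bracket R H a \<one> = 1"
proof -
  have "y = x" if y: "y \<in> H \<inter> scaled_translate R H a \<one>" for y
  proof (rule ccontr)
    assume "y \<noteq> x"
    have xy: "x \<in> H" "x \<noteq> \<one>" "y \<in> H" "y \<noteq> \<one>" using x y mem_translate_iff by blast+
    obtain s t where st: "s \<in> H" "x = s \<otimes> a \<oplus> \<one>" "t \<in> H" "y = t \<otimes> a \<oplus> \<one>"
      using x y by (auto simp: mem_scaled_translate)
    obtain t' where t': "t' \<in> H" "t' \<otimes> t = \<one>" using st(3) inverse_in_subgroup by blast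
    define w where "w = s \<otimes> t'"
    have w: "w \<in> H" unfolding w_def using st(1) t'(1) by (rule mult_mem_subgroup)
    note c = xy(1,3)[THEN mem_subgroup(1)] st(1,3)[THEN mem_subgroup(1)]
      t'(1)[THEN mem_subgroup(1)] w[THEN mem_subgroup(1)]
    have wt: "w \<otimes> t = s" unfolding w_def using c t'(2) by (simp add: m_assoc)
    \<comment> \<open>If w = 1, then s = t and the two points coincide.\<close>
    have "w \<noteq> \<one>" using wt c st \<open>y \<noteq> x\<close> by auto
    define v where "v = w \<otimes> y"
    have v: "v \<in> H" unfolding v_def using w xy(3) by (rule mult_mem_subgroup)
    note c = c v[THEN mem_subgroup(1)]
    define e where "e = \<one> \<oplus> v"
    have "v = (w \<otimes> t) \<otimes> a \<oplus> w"
      unfolding v_def st(4) by (insert c a(1), algebra)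
    hence ve: "\<one> \<oplus> v = x \<oplus> w"
      unfolding wt st(2) by (simp add: c a a_ac)
    \<comment> \<open>The centre is nonzero because v = -1 would put -1 into
      \<open>H\<close>.\<close>
    have "e \<noteq> \<zero>"
    proof
      assume "e = \<zero>"
      hence "v = \<ominus> \<one>" unfolding e_def using c by (metis add.inv_equality a_comm one_closed)
      thus False using v m1 by simp
    qed
    moreover have "\<ominus> \<one> \<noteq> \<zero>"
      by (metis minus_minus minus_zero one_closed zero_not_one)
    ultimately have le: "card ((H #> \<one>) \<inter> scaled_translate R H (\<ominus> \<one>) e) \<le> 2"
      using circ c by (simp add: circular_def e_def)
    have one: "\<one> \<in> H" using subgroup.one_closed[OF H] by simp
    have pts: "u = u' \<otimes> \<ominus> \<one> \<oplus> (u \<oplus> u')" "u' = u \<otimes> \<ominus> \<one> \<oplus> (u \<oplus> u')"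
      if "u \<in> carrier R" "u' \<in> carrier R" for u u'
      using that by algebra+
    have "\<one> = v \<otimes> \<ominus> \<one> \<oplus> e" "v = \<one> \<otimes> \<ominus> \<one> \<oplus> e"
      unfolding e_def by (rule pts; simp add: c)+
    moreover have "x = w \<otimes> \<ominus> \<one> \<oplus> e" "w = x \<otimes> \<ominus> \<one> \<oplus> e"
      unfolding e_def ve by (rule pts; simp add: c)+
    ultimately have sub: "{\<one>, v, x, w} \<subseteq> (H #> \<one>) \<inter> scaled_translate R H (\<ominus> \<one>) e"
      unfolding coset_by_one insert_subset Int_iff mem_scaled_translate using one v w xy(1) by blast
    have "v \<noteq> x"
    proof
      assume "v = x"
      hence "\<one> \<oplus> x = w \<oplus> x" using ve c by (simp add: a_comm)
      thus False using c \<open>w \<noteq> \<one>\<close> by simp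
    qed
    \<comment> \<open>The four points may coincide in pairs. If v = 1, then x = w would give 2 = 2
      w, hence w = 1; if v \<noteq> 1, then 1, v and x are already distinct.\<close>
    have "card {\<one>, v, x, w} \<ge> 3"
    proof (cases "v = \<one>")
      case True
      have "x \<noteq> w"
      proof
        assume "x = w"
        hence "\<one> \<oplus> \<one> = w \<oplus> w" using ve True by simp
        moreover have "(\<one> \<oplus> \<one>) \<otimes> (\<one> \<ominus> w) = (\<one> \<oplus> \<one>) \<ominus> (w \<oplus> w)"
          by (insert c(6), algebra)
        ultimately have "(\<one> \<oplus> \<one>) \<otimes> (\<one> \<ominus> w) = \<zero>" using c(6) by simp
        thus False using two c \<open>w \<noteq> \<one>\<close> by (auto simp: integral_iff)
      qed
      thus ?thesis using True \<open>w \<noteq> \<one>\<close> xy(2) by auto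
    next
      case False
      have "card {\<one>, v, x} \<le> card {\<one>, v, x, w}" by (intro card_mono) auto
      thus ?thesis using False \<open>v \<noteq> x\<close> xy(2) by auto
    qed
    moreover have "finite H" using fin mem_subgroup by (meson finite_subset subsetI)
    ultimately show False
      using le card_mono[OF _ sub] by (simp add: coset_by_one)
  qed
  hence "H \<inter> scaled_translate R H a \<one> = {x}" using x by blast
  thus ?thesis by (simp add: bracket_def)
qed

section \<open>Membership of -1 and the double of the subgroup\<close>

lemma minus_one_pow_even:
  assumes "even (k::nat)" shows "(\<ominus> \<one>) [^] k = \<one>"
proof -
  obtain m where "k = 2 * m" using assms ..
  moreover have "(\<ominus> \<one>) [^] (2::nat) = \<one>" by (simp add: numeral_2_eq_2 r_minus)
  ultimately show ?thesis by (simp flip: nat_pow_pow)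
qed

text \<open>\<open>H\<close> consists of the roots of X^k - 1 with k = \<open>card H\<close>, and
  for odd k the power (-1)^k = -1 differs from 1 outside characteristic 2.\<close>

lemma minus_one_mem_iff:
  assumes "\<one> \<oplus> \<one> \<noteq> \<zero>"
  shows "\<ominus> \<one> \<in> H \<longleftrightarrow> even (card H)"
proof -
  have "\<ominus> \<one> \<in> H \<longleftrightarrow> (\<ominus> \<one>) [^] card H = \<one>"
    by (subst finite_subgroup_eq_roots[OF fin H]) simp
  also have "\<dots> \<longleftrightarrow> even (card H)"
  proof
    assume *: "(\<ominus> \<one>) [^] card H = \<one>"
    show "even (card H)"
    proof (rule ccontr)
      assume "odd (card H)"
      then obtain m where m: "card H = Suc (2 * m)" by (auto elim: oddE)
      have "\<ominus> \<one> = \<one>" using * minus_one_pow_even[of "2 * m"] by (simp add: m)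
      thus False using assms r_neg[of \<one>] by simp
    qed
  qed (rule minus_one_pow_even)
  finally show ?thesis .
qed

text \<open>As -1 lies in \<open>H\<close>, the sets 2 \<open>H\<close> and \<open>H\<close> (-1 -
  1) agree, so this is the case x = -1 of \<open>mem_translate_iff\<close>; the assumption on 2
  ensures -1 \<noteq> 1.\<close>

lemma mem_double_iff:
  assumes m1: "\<ominus> \<one> \<in> H" and two: "\<one> \<oplus> \<one> \<noteq> \<zero>"
  shows "a \<in> (\<one> \<oplus> \<one>) <# H \<longleftrightarrow> \<ominus> \<one> \<in> scaled_translate R H a \<one>"
proof -
  have ne: "\<ominus> \<one> \<noteq> \<one>" using two r_neg[of \<one>] by force
  have eq: "h \<otimes> \<ominus> \<one> \<otimes> (\<ominus> \<one> \<ominus> \<one>) = (\<one> \<oplus> \<one>) \<otimes> h" 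
    "(\<one> \<oplus> \<one>) \<otimes> (h \<otimes> \<ominus> \<one>) = h \<otimes> (\<ominus> \<one> \<ominus> \<one>)" if "h \<in> H" for h
    using mem_subgroup(1)[OF that] by (simp_all add: minus_eq minus_add l_distr r_distr l_minus r_minus)
  have "a \<in> (\<one> \<oplus> \<one>) <# H \<longleftrightarrow> a \<in> H #> (\<ominus> \<one> \<ominus> \<one>)"
  proof
    assume "a \<in> (\<one> \<oplus> \<one>) <# H"
    then obtain h where h: "h \<in> H" "a = (\<one> \<oplus> \<one>) \<otimes> h" by (auto simp: l_coset_def)
    thus "a \<in> H #> (\<ominus> \<one> \<ominus> \<one>)"
      using eq(1)[OF h(1)] mult_mem_subgroup[OF h(1) m1]
      by (auto simp: r_coset_def intro!: bexI[of _ "h \<otimes> \<ominus> \<one>"])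
  next
    assume "a \<in> H #> (\<ominus> \<one> \<ominus> \<one>)"
    then obtain h where h: "h \<in> H" "a = h \<otimes> (\<ominus> \<one> \<ominus> \<one>)" by (auto simp: r_coset_def)
    thus "a \<in> (\<one> \<oplus> \<one>) <# H"
      using eq(2)[OF h(1)] mult_mem_subgroup[OF h(1) m1]
      by (auto simp: l_coset_def intro!: bexI[of _ "h \<otimes> \<ominus> \<one>"])
  qed
  thus ?thesis using mem_translate_iff[of "\<ominus> \<one>"] m1 ne by simp
qed

lemma bracket_eq_0:
  assumes "\<not> (\<exists>x\<in>H - {\<one>}. a \<in> H #> (x \<ominus> \<one>))"
  shows "bracket R H a \<one> = 0"
proof -
  have "H \<inter> scaled_translate R H a \<one> = {}" using assms mem_translate_iff by blast
  thus ?thesis by (simp add: bracket_def)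
qed

end

section \<open>The values of the bracket, case by case\<close>

theorem theorem15:
  fixes F :: "('a, 'm) ring_scheme" (structure)
    and \<Phi> :: "'a set" and a :: 'a and p r q k :: nat
  assumes "Factorial_Ring.prime p"
    and "q = p ^ r"
    and "k \<ge> 3" and "k dvd q - 1"
    and "is_GF q F"
    and "subgroup \<Phi> (Multiplicative_Group.mult_of F)" and "card \<Phi> = k"
    and "circular_pair p k"
    and "a \<in> carrier (Multiplicative_Group.mult_of F)"
  shows "(even k \<longrightarrow>
            ((\<exists>\<psi> \<in> \<Phi> - {\<one>, \<ominus> \<one>}. a \<in> \<Phi> #> (\<psi> \<ominus> \<one>)) \<longrightarrow> bracket F \<Phi> a \<one> = 2) \<and>
            (a \<in> (\<one> \<oplus> \<one>) <# \<Phi> \<longrightarrow> bracket F \<Phi> a \<one> = 1) \<and>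
            (\<not> (\<exists>\<psi> \<in> \<Phi> - {\<one>, \<ominus> \<one>}. a \<in> \<Phi> #> (\<psi> \<ominus> \<one>)) \<and> a \<notin> (\<one> \<oplus> \<one>) <# \<Phi>
               \<longrightarrow> bracket F \<Phi> a \<one> = 0)) \<and>
         (odd k \<longrightarrow>
            (p = 2 \<and> (\<exists>\<psi> \<in> \<Phi> - {\<one>}. a \<in> \<Phi> #> (\<psi> \<ominus> \<one>)) \<longrightarrow> bracket F \<Phi> a \<one> = 2) \<and>
            (p \<noteq> 2 \<and> (\<exists>\<psi> \<in> \<Phi> - {\<one>}. a \<in> \<Phi> #> (\<psi> \<ominus> \<one>)) \<longrightarrow> bracket F \<Phi> a \<one> = 1) \<and>
            (\<not> (\<exists>\<psi> \<in> \<Phi> - {\<one>}. a \<in> \<Phi> #> (\<psi> \<ominus> \<one>)) \<longrightarrow> bracket F \<Phi> a \<one> = 0))"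
proof -
  have F: "field F" "finite (carrier F)" "card (carrier F) = p ^ r"
    using assms(2,5) by (auto simp: is_GF_def)
  have H: "subgroup \<Phi> (mult_of F)" by fact
  interpret field F by (rule F)
  have a: "a \<in> carrier F" "a \<noteq> \<zero>" using assms(9) by auto
  note ctx = F(1,2) H a
  obtain s and E :: "nat ring" and \<Psi> where E: "is_GF (p ^ s) E" "subgroup \<Psi> (mult_of E)"
    "card \<Psi> = k" "circular E \<Psi>"
    using assms(8) by (auto simp: circular_pair_def)
  have circ: "circular F \<Phi>"
    using circular_transfer[OF F assms(1) _ _ _ H E(2) _ E(4)] E(1,3) assms(7)
    by (auto simp: is_GF_def)
  have "\<one> \<oplus> \<one> = int_emb (1 + 1)" by (simp only: int_emb_add int_emb_1)
  hence "\<one> \<oplus> \<one> = \<zero> \<longleftrightarrow> int p dvd 2"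
    using int_emb_eq_0_iff[OF F(2,3) assms(1)] by simp
  also have "\<dots> \<longleftrightarrow> p = 2"
    using assms(1) by (metis int_dvd_int_iff of_nat_numeral primes_dvd_imp_eq two_is_prime_nat dvd_refl)
  finally have two: "\<one> \<oplus> \<one> = \<zero> \<longleftrightarrow> p = 2" .
  note mem = mem_translate_iff[OF ctx]
  \<comment> \<open>An even k dividing q - 1 makes q odd. For p = 2 that would force q = 1, which is
    impossible because 0 and 1 are distinct elements of the field.\<close>
  have p_odd: "p \<noteq> 2" if "even k"
  proof
    assume "p = 2"
    moreover have "card {\<zero>, \<one>} \<le> card (carrier F)" using F(2) by (intro card_mono) auto
    ultimately have "even q" "q > 0" using F(3) assms(2) by (auto intro: Nat.gr0I)
    hence "odd (q - 1)" by simp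
    thus False using that assms(4) dvd_trans by blast
  qed
  show ?thesis
  proof (intro conjI impI)
    assume "even k" and "\<exists>\<psi>\<in>\<Phi> - {\<one>, \<ominus> \<one>}. a \<in> \<Phi> #> (\<psi> \<ominus> \<one>)"
    then obtain \<psi> where "\<psi> \<in> \<Phi> \<inter> scaled_translate F \<Phi> a \<one>" "\<psi> \<noteq> \<ominus> \<one>" using mem by blast
    moreover have "\<ominus> \<one> \<in> \<Phi>"
      using minus_one_mem_iff[OF ctx] two p_odd \<open>even k\<close> assms(7) by simp
    ultimately show "bracket F \<Phi> a \<one> = 2" using bracket_eq_2[OF ctx circ] by blast
  next
    assume "even k" and a2: "a \<in> (\<one> \<oplus> \<one>) <# \<Phi>"
    have m1: "\<ominus> \<one> \<in> \<Phi>"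
      using minus_one_mem_iff[OF ctx] two p_odd \<open>even k\<close> assms(7) by simp
    thus "bracket F \<Phi> a \<one> = 1"
      using bracket_eq_1_even[OF ctx circ] mem_double_iff[OF ctx] a2 two p_odd \<open>even k\<close> by simp
  next
    assume "even k"
      and no: "\<not> (\<exists>\<psi>\<in>\<Phi> - {\<one>, \<ominus> \<one>}. a \<in> \<Phi> #> (\<psi> \<ominus> \<one>)) \<and> a \<notin> (\<one> \<oplus> \<one>) <# \<Phi>"
    have m1: "\<ominus> \<one> \<in> \<Phi>"
      using minus_one_mem_iff[OF ctx] two p_odd \<open>even k\<close> assms(7) by simp
    hence "\<ominus> \<one> \<notin> scaled_translate F \<Phi> a \<one>"
      using mem_double_iff[OF ctx] no two p_odd \<open>even k\<close> by simp
    \<comment> \<open>The value x = -1 has just been excluded, and \<open>no\<close> covers every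
      other x \<noteq> 1.\<close>
    hence "\<not> (\<exists>x\<in>\<Phi> - {\<one>}. a \<in> \<Phi> #> (x \<ominus> \<one>))" using no mem[of "\<ominus> \<one>"] m1 by blast
    thus "bracket F \<Phi> a \<one> = 0" by (rule bracket_eq_0[OF ctx])
  next
    assume "odd k" and ex: "p = 2 \<and> (\<exists>\<psi>\<in>\<Phi> - {\<one>}. a \<in> \<Phi> #> (\<psi> \<ominus> \<one>))"
    then obtain \<psi> where psi: "\<psi> \<in> \<Phi> \<inter> scaled_translate F \<Phi> a \<one>" "\<psi> \<noteq> \<one>" using mem by blast
    \<comment> \<open>In characteristic 2 the odd case also has -1 = 1 in \<Phi>, so the inversion
      argument applies.\<close>
    have "\<ominus> \<one> = \<one>" using two ex by (metis add.inv_equality one_closed)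
    moreover have "\<one> \<in> \<Phi>" using subgroup.one_closed[OF H] by simp
    ultimately show "bracket F \<Phi> a \<one> = 2" using bracket_eq_2[OF ctx circ] psi by simp
  next
    assume "odd k" and ex: "p \<noteq> 2 \<and> (\<exists>\<psi>\<in>\<Phi> - {\<one>}. a \<in> \<Phi> #> (\<psi> \<ominus> \<one>))"
    then obtain \<psi> where "\<psi> \<in> \<Phi> \<inter> scaled_translate F \<Phi> a \<one>" using mem by blast
    moreover have "\<ominus> \<one> \<notin> \<Phi>"
      using minus_one_mem_iff[OF ctx] two ex \<open>odd k\<close> assms(7) by simp
    ultimately show "bracket F \<Phi> a \<one> = 1" using bracket_eq_1_odd[OF ctx circ] two ex by blast
  next
    assume "\<not> (\<exists>\<psi>\<in>\<Phi> - {\<one>}. a \<in> \<Phi> #> (\<psi> \<ominus> \<one>))"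
    thus "bracket F \<Phi> a \<one> = 0" by (rule bracket_eq_0[OF ctx])
  qed
qed

end
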